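(* Let $b\ge 2$ be an integer, let $T=(t_1,\ldots,t_b)$ be a $b$-tuple of positive integers, and let $w_T(n|z_1,\ldots,z_b)$ be the base $b$ Stern polynomials. For an integer $N\ge 0$ let $l_N:=\frac{b^{N+1}-1}{b-1}$. Then $$\prod_{i=0}^{N-1}\left(2+\sum_{j=2}^b z_j^{t_j^i}\right)=\sum_{n=l_N-b^N+2}^{l_N+1}w_T(n|1,z_2,z_3,\ldots,z_b).$$
   Context: Fix an integer $b\ge 2$ and a tuple $T=(t_1,\ldots,t_b)$ of positive integers. The base $b$ Stern polynomials $w_T(n|z_1,\ldots,z_b)\in\mathbb{Z}[z_1,\ldots,z_b]$ are defined by $w_T(0|z_1,\ldots,z_b)=0$, $w_T(1|z_1,\ldots,z_b)=1$, and for $n\ge 1$ by $$w_T(b(n-1)+j+1|z_1,\ldots,z_b)=z_j\,w_T(n|z_1^{t_1},\ldots,z_b^{t_b})\quad(1\le j\le b-1),$$ $$w_T(bn+1|z_1,\ldots,z_b)=z_b\,w_T(n|z_1^{t_1},\ldots,z_b^{t_b})+w_T(n+1|z_1^{t_1},\ldots,z_b^{t_b}).$$ Here $z_j^{t_j^i}$ means $z_j$ raised to the power $(t_j)^i$, with $(t_j)^0=1$. The notation $w_T(n|1,z_2,\ldots,z_b)$ means the polynomial evaluated at $z_1=1$. An empty product equals $1$. *)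

theory Defs
  imports Complex_Main "HOL-Library.Poly_Mapping"
begin

text \<open>
  Polynomials over the integers in variables indexed by natural numbers: finitely supported
  maps from monomials (finitely supported exponent vectors) to coefficients. The ring in the
  variables \<open>z\<^sub>1, \<dots>, z\<^sub>b\<close> is the subring of those polynomials that only mention the indices
  \<open>1, \<dots>, b\<close>.
\<close>

type_synonym int_mpoly = "(nat \<Rightarrow>\<^sub>0 nat) \<Rightarrow>\<^sub>0 int"

definition Var :: "nat \<Rightarrow> int_mpoly"
  where "Var i = Poly_Mapping.single (Poly_Mapping.single i 1) 1"

definition mpoly_subst :: "(nat \<Rightarrow> int_mpoly) \<Rightarrow> int_mpoly \<Rightarrow> int_mpoly"
  where "mpoly_subst f p =
    (\<Sum>m\<in>Poly_Mapping.keys p. of_int (Poly_Mapping.lookup p m) *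
      (\<Prod>i\<in>Poly_Mapping.keys m. f i ^ Poly_Mapping.lookup m i))"

lemma mpoly_subst_superset:
  assumes "finite A" "Poly_Mapping.keys p \<subseteq> A"
  shows "mpoly_subst f p = (\<Sum>m\<in>A. of_int (Poly_Mapping.lookup p m) *
    (\<Prod>i\<in>Poly_Mapping.keys m. f i ^ Poly_Mapping.lookup m i))"
  unfolding mpoly_subst_def using assms
  by (intro sum.mono_neutral_left) (auto simp: in_keys_iff)

lemma mpoly_subst_single:
  "mpoly_subst f (Poly_Mapping.single m c) =
    of_int c * (\<Prod>i\<in>Poly_Mapping.keys m. f i ^ Poly_Mapping.lookup m i)"
  by (subst mpoly_subst_superset[where A = "{m}"]) auto

lemma mpoly_subst_zero: "mpoly_subst f 0 = 0"
  by (simp add: mpoly_subst_def)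

lemma mpoly_subst_one: "mpoly_subst f 1 = 1"
  by (simp add: mpoly_subst_single flip: single_one)

lemma mpoly_subst_Var: "mpoly_subst f (Var i) = f i"
  by (simp add: Var_def mpoly_subst_single)

lemma mpoly_subst_add: "mpoly_subst f (p + q) = mpoly_subst f p + mpoly_subst f q"
proof -
  let ?A = "Poly_Mapping.keys p \<union> Poly_Mapping.keys q"
  have "finite ?A" by simp
  then show ?thesis
    using keys_add[of p q]
    by (simp add: mpoly_subst_superset[where A = ?A] lookup_add distrib_right sum.distrib)
qed

lemma mpoly_subst_mult: "mpoly_subst f (p * q) = mpoly_subst f p * mpoly_subst f q"
proof -
  let ?e = "\<lambda>m. \<Prod>i\<in>Poly_Mapping.keys m. f i ^ Poly_Mapping.lookup m i"
  have e_super: "?e m = (\<Prod>i\<in>A. f i ^ Poly_Mapping.lookup m i)"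
    if "finite A" "Poly_Mapping.keys m \<subseteq> A" for m A
    using that by (intro prod.mono_neutral_left) (auto simp: in_keys_iff)
  have e_add: "?e (m + k) = ?e m * ?e k" for m k :: "nat \<Rightarrow>\<^sub>0 nat"
  proof -
    let ?A = "Poly_Mapping.keys m \<union> Poly_Mapping.keys k"
    have "finite ?A" by simp
    then show ?thesis
      using keys_add[of m k] e_super[of ?A m] e_super[of ?A k] e_super[of ?A "m + k"]
      by (simp add: lookup_add power_add prod.distrib)
  qed
  have sum_subst: "mpoly_subst f (sum g A) = (\<Sum>x\<in>A. mpoly_subst f (g x))"
    for g :: "(nat \<Rightarrow>\<^sub>0 nat) \<Rightarrow> int_mpoly" and A
    by (induction A rule: infinite_finite_induct)
      (simp_all add: mpoly_subst_zero mpoly_subst_add)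
  have expand: "r = (\<Sum>m\<in>Poly_Mapping.keys r. Poly_Mapping.single m (Poly_Mapping.lookup r m))"
    for r :: int_mpoly
    by (rule poly_mapping_eqI)
      (auto simp: lookup_sum lookup_single when_def in_keys_iff sum.delta)
  have "p * q = (\<Sum>m\<in>Poly_Mapping.keys p. \<Sum>k\<in>Poly_Mapping.keys q.
      Poly_Mapping.single (m + k) (Poly_Mapping.lookup p m * Poly_Mapping.lookup q k))"
    by (subst expand[of p], subst expand[of q]) (simp add: sum_product mult_single)
  then show ?thesis
    unfolding mpoly_subst_def[of f p] mpoly_subst_def[of f q]
    by (simp add: sum_subst mpoly_subst_single e_add sum_product mult_ac)
qed

text \<open>
  The tuple \<open>T\<close> is a function on indices, of which only the values at \<open>1, \<dots>, b\<close> matter.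
  Every \<open>n \<ge> 2\<close> is uniquely \<open>b (m - 1) + j + 1\<close> with \<open>m \<ge> 1\<close> and \<open>1 \<le> j \<le> b\<close>; the case
  \<open>j = b\<close> is \<open>n = b m + 1\<close>. For the junk case \<open>b < 2\<close> the value is \<open>0\<close>. The recurrences in
  their usual form are \<open>stern_lt\<close> and \<open>stern_eq\<close> below.
\<close>

function stern :: "nat \<Rightarrow> (nat \<Rightarrow> nat) \<Rightarrow> nat \<Rightarrow> int_mpoly" where
  "stern b t n =
    (if b < 2 \<or> n = 0 then 0
     else if n = 1 then 1
     else let m = (n - 2) div b + 1; j = (n - 2) mod b + 1 in
       if j < b then Var j * mpoly_subst (\<lambda>i. Var i ^ t i) (stern b t m)
       else Var b * mpoly_subst (\<lambda>i. Var i ^ t i) (stern b t m)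
            + mpoly_subst (\<lambda>i. Var i ^ t i) (stern b t (m + 1)))"
  by auto
termination
proof (relation "measure (\<lambda>(b, t, n). n)", goal_cases)
  case 1
  show ?case by simp
next
  case (2 b t n m j)
  have "(n - 2) div b \<le> n - 2" by simp
  then have "(n - 2) div b + 1 < n" using 2(1,2) by linarith
  with 2 show ?case by simp
next
  case (3 b t n m j)
  have "(n - 2) div b \<le> n - 2" by simp
  then have "(n - 2) div b + 1 < n" using 3(1,2) by linarith
  with 3 show ?case by simp
next
  case (4 b t n m j)
  have "n - 2 = b * ((n - 2) div b) + (n - 2) mod b" by simp
  moreover have "2 * ((n - 2) div b) \<le> b * ((n - 2) div b)" using 4 by simp
  moreover have "(n - 2) mod b + 1 \<ge> b" using 4 by simp
  ultimately have "(n - 2) div b + 2 < n" using 4 by linarith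
  with 4 show ?case by simp
qed

declare stern.simps [simp del]

lemma stern_0: "stern b t 0 = 0"
  by (simp add: stern.simps)

lemma stern_1: "b \<ge> 2 \<Longrightarrow> stern b t 1 = 1"
  by (subst stern.simps) simp

lemma stern_lt:
  assumes "b \<ge> 2" "n \<ge> 1" "1 \<le> j" "j \<le> b - 1"
  shows "stern b t (b * (n - 1) + j + 1) = Var j * mpoly_subst (\<lambda>i. Var i ^ t i) (stern b t n)"
proof -
  have "b * (n - 1) + j + 1 - 2 = (j - 1) + b * (n - 1)" using assms by simp
  moreover have "j - 1 < b" using assms by simp
  then have "((j - 1) + b * (n - 1)) div b = n - 1" "((j - 1) + b * (n - 1)) mod b = j - 1"
    by simp_all
  moreover have "j < b" using assms by simp
  ultimately show ?thesis
    using assms by (subst stern.simps) (simp add: Let_def)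
qed

lemma stern_eq:
  assumes "b \<ge> 2" "n \<ge> 1"
  shows "stern b t (b * n + 1) =
    Var b * mpoly_subst (\<lambda>i. Var i ^ t i) (stern b t n) + mpoly_subst (\<lambda>i. Var i ^ t i) (stern b t (n + 1))"
proof -
  have "b * n = b + b * (n - 1)" using assms by (cases n) auto
  then have "b * n + 1 - 2 = (b - 1) + b * (n - 1)" using assms by simp
  moreover have "b - 1 < b" using assms by simp
  then have "((b - 1) + b * (n - 1)) div b = n - 1" "((b - 1) + b * (n - 1)) mod b = b - 1"
    by (simp_all only: div_mult_self2 mod_mult_self2 div_less mod_less)
  ultimately show ?thesis
    using assms by (subst stern.simps) (simp add: Let_def)
qed

definition ell :: "nat \<Rightarrow> nat \<Rightarrow> nat"
  where "ell b N = (b ^ (N + 1) - 1) div (b - 1)"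

text \<open>The division is exact, and \<open>ell b N - b ^ N\<close> does not truncate.\<close>

lemma ell_exact:
  assumes "b \<ge> 2"
  shows "(b - 1) * ell b N = b ^ (N + 1) - 1" and "b ^ N \<le> ell b N"
proof -
  have *: "b ^ (N + 1) - 1 = (b - 1) * (\<Sum>i<N + 1. b ^ i)"
  proof (induction N)
    case (Suc N)
    have "b ^ (Suc N + 1) - 1 = (b ^ (N + 1) - 1) + (b - 1) * b ^ (N + 1)"
    proof -
      have "b ^ (N + 1) \<ge> 1" using assms by simp
      moreover have "b ^ (Suc N + 1) = b ^ (N + 1) + (b - 1) * b ^ (N + 1)"
        using assms by (cases b) auto
      ultimately show ?thesis by linarith
    qed
    then show ?case using Suc by (simp add: distrib_left)
  qed simp
  have e: "ell b N = (\<Sum>i<N + 1. b ^ i)"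
    using assms unfolding ell_def * by (subst nonzero_mult_div_cancel_left) auto
  show "(b - 1) * ell b N = b ^ (N + 1) - 1" unfolding e * ..
  show "b ^ N \<le> ell b N" unfolding e by simp
qed

end

theory Submission
  imports Defs
begin

text \<open>
  Let \<open>v n\<close> be the polynomial \<open>stern b t n\<close> at \<open>z\<^sub>1 = 1\<close>, let \<open>S\<close> be the substitution
  \<open>z\<^sub>j \<mapsto> z\<^sub>j ^ t j\<close>, and write \<open>L N = 1 + b + \<dots> + b ^ (N - 1)\<close>, so that \<open>ell b N = L (N + 1)\<close>
  and \<open>ell b N - b ^ N = L N\<close>. The sum in the theorem is then the sum \<open>F N\<close> of \<open>v n\<close> over
  \<open>L N + 2 \<le> n < L (N + 1) + 2\<close>, and the theorem follows by induction from
  \<open>F (N + 1) = (2 + z\<^sub>2 + \<dots> + z\<^sub>b) * S (F N)\<close>, because \<open>S\<close> turns the factor with index \<open>i\<close> of the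
  product into the factor with index \<open>i + 1\<close>.

  To see this recursion, note that setting \<open>z\<^sub>1 = 1\<close> commutes with \<open>S\<close>, so \<open>v\<close> satisfies the
  recurrences of the Stern polynomials with \<open>z\<^sub>1\<close> replaced by \<open>1\<close>. Since \<open>L (N + 1) = b * L N + 1\<close>,
  the range of \<open>F (N + 1)\<close> splits into the blocks \<open>b * m + 3, \<dots>, b * m + b + 2\<close> with
  \<open>L N \<le> m < L (N + 1)\<close>. In block \<open>m\<close>, \<open>S (v (m + 1))\<close> occurs with the weights
  \<open>z\<^sub>2, \<dots>, z\<^sub>b\<close>, and \<open>S (v (m + 2))\<close> occurs twice with weight \<open>1\<close>
  (\<open>stern_at_one_block_sum\<close>). The sum of \<open>S (v (m + 2))\<close> over all blocks is \<open>S (F N)\<close>; that of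
  \<open>S (v (m + 1))\<close> runs over a range shifted by one, and the two agree because the terms by which
  the ranges differ, \<open>v (L N + 1)\<close> and \<open>v (L (N + 1) + 1)\<close>, are both \<open>1\<close>.
\<close>

section \<open>Substitution as a ring homomorphism\<close>

lemma mpoly_subst_of_int: "mpoly_subst f (of_int c) = of_int c"
proof -
  have "of_int c = (Poly_Mapping.single 0 c :: int_mpoly)"
    by (metis of_int_eq_id id_apply single_of_int)
  then show ?thesis
    using mpoly_subst_single[of f 0 c] by simp
qed

lemma mpoly_subst_sum: "mpoly_subst f (sum g A) = (\<Sum>x\<in>A. mpoly_subst f (g x))"
  by (induction A rule: infinite_finite_induct)
    (simp_all add: mpoly_subst_zero mpoly_subst_add)

lemma mpoly_subst_prod: "mpoly_subst f (prod g A) = (\<Prod>x\<in>A. mpoly_subst f (g x))"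
  by (induction A rule: infinite_finite_induct)
    (simp_all add: mpoly_subst_one mpoly_subst_mult)

lemma mpoly_subst_power: "mpoly_subst f (p ^ k) = mpoly_subst f p ^ k"
  by (induction k) (simp_all add: mpoly_subst_one mpoly_subst_mult)

lemma mpoly_subst_compose:
  "mpoly_subst f (mpoly_subst g p) = mpoly_subst (\<lambda>i. mpoly_subst f (g i)) p"
  unfolding mpoly_subst_def[of g p] mpoly_subst_def[of "\<lambda>i. mpoly_subst f (g i)" p]
  by (simp add: mpoly_subst_sum mpoly_subst_mult mpoly_subst_of_int mpoly_subst_prod
      mpoly_subst_power)

section \<open>Stern polynomials at \<open>z\<^sub>1 = 1\<close>\<close>

definition at_one :: "int_mpoly \<Rightarrow> int_mpoly"
  where "at_one = mpoly_subst (\<lambda>i. if i = 1 then 1 else Var i)"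

definition pow_vars :: "(nat \<Rightarrow> nat) \<Rightarrow> int_mpoly \<Rightarrow> int_mpoly"
  where "pow_vars t = mpoly_subst (\<lambda>i. Var i ^ t i)"

text \<open>Both sides send \<open>z\<^sub>1\<close> to \<open>1\<close>, since \<open>1\<close> is fixed by raising to a power.\<close>

lemma at_one_pow_vars: "at_one (pow_vars t p) = pow_vars t (at_one p)"
proof -
  have "(\<lambda>i. mpoly_subst (\<lambda>i. if i = 1 then 1 else Var i) (Var i ^ t i)) =
      (\<lambda>i. mpoly_subst (\<lambda>i. Var i ^ t i) (if i = 1 then 1 else Var i))"
    by (auto simp: mpoly_subst_power mpoly_subst_Var mpoly_subst_one)
  then show ?thesis
    unfolding at_one_def pow_vars_def mpoly_subst_compose by (rule arg_cong)
qed

definition stern_at_one :: "nat \<Rightarrow> (nat \<Rightarrow> nat) \<Rightarrow> nat \<Rightarrow> int_mpoly"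
  where "stern_at_one b t n = at_one (stern b t n)"

lemma stern_at_one_1: "b \<ge> 2 \<Longrightarrow> stern_at_one b t 1 = 1"
  unfolding stern_at_one_def at_one_def using stern_1[of b t] by (simp add: mpoly_subst_one)

lemma stern_at_one_first:
  assumes "b \<ge> 2"
  shows "stern_at_one b t (b * m + 2) = pow_vars t (stern_at_one b t (m + 1))"
proof -
  have "stern b t (b * m + 2) = Var 1 * pow_vars t (stern b t (m + 1))"
    using stern_lt[of b "m + 1" 1 t] assms unfolding pow_vars_def by simp
  then show ?thesis
    unfolding stern_at_one_def at_one_pow_vars[symmetric]
    by (simp add: at_one_def mpoly_subst_mult mpoly_subst_Var)
qed

lemma stern_at_one_middle:
  assumes "b \<ge> 2" "2 \<le> j" "j < b"
  shows "stern_at_one b t (b * m + j + 1) = Var j * pow_vars t (stern_at_one b t (m + 1))"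
proof -
  have "stern b t (b * m + j + 1) = Var j * pow_vars t (stern b t (m + 1))"
    using stern_lt[of b "m + 1" j t] assms unfolding pow_vars_def by simp
  then show ?thesis
    unfolding stern_at_one_def at_one_pow_vars[symmetric]
    using assms by (simp add: at_one_def mpoly_subst_mult mpoly_subst_Var)
qed

lemma stern_at_one_last:
  assumes "b \<ge> 2"
  shows "stern_at_one b t (b * m + b + 1) =
    Var b * pow_vars t (stern_at_one b t (m + 1)) + pow_vars t (stern_at_one b t (m + 2))"
proof -
  have "stern b t (b * m + b + 1) =
      Var b * pow_vars t (stern b t (m + 1)) + pow_vars t (stern b t (m + 2))"
    using stern_eq[of b "m + 1" t] assms unfolding pow_vars_def by (simp add: add_ac)
  then show ?thesis
    unfolding stern_at_one_def at_one_pow_vars[symmetric]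
    using assms by (simp add: at_one_def mpoly_subst_mult mpoly_subst_add mpoly_subst_Var)
qed

text \<open>
  The block deliberately starts at the residue \<open>j = 2\<close> and ends with the first index of the next
  run of \<open>b\<close> consecutive indices. That last index gives the second copy of the term at \<open>m + 2\<close>, the
  first one coming from the additional summand of the recurrence at \<open>j = b\<close>.
\<close>

lemma stern_at_one_block_sum:
  assumes "b \<ge> 2"
  shows "(\<Sum>j=2..b + 1. stern_at_one b t (b * m + j + 1)) =
    (\<Sum>j=2..b. Var j) * pow_vars t (stern_at_one b t (m + 1)) +
    2 * pow_vars t (stern_at_one b t (m + 2))"
proof -
  let ?v = "stern_at_one b t" and ?S = "pow_vars t"
  have split: "{2..b} = insert b {2..<b}" "{2..b + 1} = insert (b + 1) (insert b {2..<b})"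
    using assms by auto
  have "(\<Sum>j\<in>{2..<b}. ?v (b * m + j + 1)) = (\<Sum>j\<in>{2..<b}. Var j * ?S (?v (m + 1)))"
    using assms by (intro sum.cong refl stern_at_one_middle) auto
  moreover have "?v (b * m + (b + 1) + 1) = ?S (?v (m + 2))"
    using stern_at_one_first[OF assms, of t "m + 1"] by (simp add: algebra_simps)
  ultimately show ?thesis
    unfolding split
    using stern_at_one_last[OF assms, of t m]
    by (simp add: sum_distrib_right algebra_simps del: One_nat_def add_Suc_right)
qed

section \<open>The sums over the ranges between repunits\<close>

definition repunit :: "nat \<Rightarrow> nat \<Rightarrow> nat"
  where "repunit b N = (\<Sum>i<N. b ^ i)"

lemma repunit_Suc: "repunit b (Suc N) = b * repunit b N + 1"
  unfolding repunit_def sum.lessThan_Suc_shift by (simp add: sum_distrib_left)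

lemma repunit_Suc': "repunit b (Suc N) = repunit b N + b ^ N"
  unfolding repunit_def by simp

lemma ell_eq_repunit:
  assumes "b \<ge> 2"
  shows "ell b N = repunit b (Suc N)"
proof -
  have "(b - 1) * repunit b k = b ^ k - 1" for k
    using power_diff_1_eq[of "int b" k] assms
    by (simp add: repunit_def of_nat_diff flip: of_nat_eq_iff[where 'a = int])
  then have "(b - 1) * ell b N = (b - 1) * repunit b (Suc N)"
    using ell_exact(1)[OF assms, of N] by simp
  then show ?thesis
    using assms by simp
qed

text \<open>
  As \<open>L (N + 1) + 1 = b * L N + 2\<close>, the recurrence at \<open>j = 1\<close> leads from each of these indices to
  the previous one, down to \<open>1\<close>: the Stern polynomials there are powers of \<open>z\<^sub>1\<close> alone.
\<close>

lemma stern_at_one_repunit: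
  assumes "b \<ge> 2"
  shows "stern_at_one b t (repunit b N + 1) = 1"
proof (induction N)
  case 0
  show ?case using stern_at_one_1[OF assms] by (simp add: repunit_def)
next
  case (Suc N)
  have "stern_at_one b t (repunit b (Suc N) + 1) =
      pow_vars t (stern_at_one b t (repunit b N + 1))"
    using stern_at_one_first[OF assms, of t "repunit b N"] by (simp add: repunit_Suc)
  then show ?case
    using Suc by (simp add: pow_vars_def mpoly_subst_one)
qed

lemma sum_blocks:
  fixes f :: "nat \<Rightarrow> 'a::comm_monoid_add"
  assumes "a \<le> c"
  shows "(\<Sum>n = b * a + 3..<b * c + 3. f n) = (\<Sum>m = a..<c. \<Sum>j=2..b + 1. f (b * m + j + 1))"
  using assms
proof (induction c rule: dec_induct)
  case base
  show ?case by simp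
next
  case (step c)
  have "(\<Sum>n = b * c + 3..<b * Suc c + 3. f n) = (\<Sum>j=2..b + 1. f (b * c + j + 1))"
    by (rule sum.reindex_bij_witness[where i = "\<lambda>j. b * c + j + 1" and j = "\<lambda>n. n - (b * c + 1)"])
      auto
  moreover have "(\<Sum>n = b * a + 3..<b * Suc c + 3. f n) =
      (\<Sum>n = b * a + 3..<b * c + 3. f n) + (\<Sum>n = b * c + 3..<b * Suc c + 3. f n)"
    using step.hyps by (intro sum.atLeastLessThan_concat[symmetric]) auto
  ultimately show ?case
    using step by simp
qed

definition repunit_sum :: "nat \<Rightarrow> (nat \<Rightarrow> nat) \<Rightarrow> nat \<Rightarrow> int_mpoly"
  where "repunit_sum b t N =
    (\<Sum>n = repunit b N + 2..<repunit b (Suc N) + 2. stern_at_one b t n)"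

text \<open>
  Lowering the range by one index exchanges the term at \<open>L (N + 1) + 1\<close> for the one at \<open>L N + 1\<close>,
  and both are \<open>1\<close>.
\<close>

lemma repunit_sum_shift:
  assumes "b \<ge> 2"
  shows "(\<Sum>m = repunit b N..<repunit b (Suc N). stern_at_one b t (m + 1)) = repunit_sum b t N"
    and "(\<Sum>m = repunit b N..<repunit b (Suc N). stern_at_one b t (m + 2)) = repunit_sum b t N"
proof -
  let ?a = "repunit b N" and ?c = "repunit b (Suc N)" and ?v = "stern_at_one b t"
  have le: "?a \<le> ?c"
    by (simp add: repunit_Suc')
  show two: "(\<Sum>m = ?a..<?c. ?v (m + 2)) = repunit_sum b t N"
    unfolding repunit_sum_def by (rule sum.shift_bounds_nat_ivl[symmetric])
  have "(\<Sum>m = ?a..<?c. ?v (m + 2)) - (\<Sum>m = ?a..<?c. ?v (m + 1)) = ?v (?c + 1) - ?v (?a + 1)"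
    using sum_Suc_diff'[OF le, of "\<lambda>m. ?v (m + 1)"] by (simp add: sum_subtractf)
  then show "(\<Sum>m = ?a..<?c. ?v (m + 1)) = repunit_sum b t N"
    unfolding two stern_at_one_repunit[OF assms] by simp
qed

lemma repunit_sum_Suc:
  assumes "b \<ge> 2"
  shows "repunit_sum b t (Suc N) = (2 + (\<Sum>j=2..b. Var j)) * pow_vars t (repunit_sum b t N)"
proof -
  let ?a = "repunit b N" and ?c = "repunit b (Suc N)" and ?v = "stern_at_one b t"
  have S_sum: "(\<Sum>m\<in>A. pow_vars t (g m)) = pow_vars t (sum g A)" for A :: "nat set" and g
    by (simp add: pow_vars_def mpoly_subst_sum)
  have "repunit_sum b t (Suc N) = (\<Sum>n = b * ?a + 3..<b * ?c + 3. ?v n)"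
    unfolding repunit_sum_def repunit_Suc[of b "Suc N"]
    by (subst repunit_Suc) (simp add: numeral_3_eq_3 numeral_2_eq_2)
  also have "\<dots> = (\<Sum>m = ?a..<?c. \<Sum>j=2..b + 1. ?v (b * m + j + 1))"
    by (rule sum_blocks) (simp add: repunit_Suc')
  also have "\<dots> = (\<Sum>j=2..b. Var j) * pow_vars t (\<Sum>m = ?a..<?c. ?v (m + 1)) +
      2 * pow_vars t (\<Sum>m = ?a..<?c. ?v (m + 2))"
    unfolding stern_at_one_block_sum[OF assms] sum.distrib
    by (simp only: sum_distrib_left[symmetric] S_sum)
  also have "\<dots> = (2 + (\<Sum>j=2..b. Var j)) * pow_vars t (repunit_sum b t N)"
    unfolding repunit_sum_shift[OF assms] by (simp only: distrib_right add.commute)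
  finally show ?thesis .
qed

section \<open>The product formula\<close>

lemma pow_vars_factor:
  "pow_vars t (2 + (\<Sum>j=2..b. Var j ^ (t j ^ i))) = 2 + (\<Sum>j=2..b. Var j ^ (t j ^ Suc i))"
proof -
  have "pow_vars t 2 = 2"
    unfolding pow_vars_def using mpoly_subst_of_int[of _ 2] by simp
  then show ?thesis
    by (simp add: pow_vars_def mpoly_subst_add mpoly_subst_sum mpoly_subst_power mpoly_subst_Var
        power_mult)
qed

lemma prod_eq_repunit_sum:
  assumes "b \<ge> 2"
  shows "(\<Prod>i<N. 2 + (\<Sum>j=2..b. Var j ^ (t j ^ i))) = repunit_sum b t N"
proof (induction N)
  case 0
  have "repunit_sum b t 0 = stern_at_one b t (repunit b 1 + 1)"
    by (simp add: repunit_sum_def repunit_def numeral_2_eq_2)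
  then show ?case
    unfolding stern_at_one_repunit[OF assms] by simp
next
  case (Suc N)
  let ?g = "\<lambda>i. 2 + (\<Sum>j=2..b. Var j ^ (t j ^ i))"
  have "(\<Prod>i<Suc N. ?g i) = ?g 0 * (\<Prod>i<N. ?g (Suc i))"
    by (rule prod.lessThan_Suc_shift)
  also have "(\<Prod>i<N. ?g (Suc i)) = pow_vars t (\<Prod>i<N. ?g i)"
    unfolding pow_vars_factor[symmetric] by (simp only: pow_vars_def mpoly_subst_prod)
  also have "?g 0 * \<dots> = repunit_sum b t (Suc N)"
    unfolding Suc repunit_sum_Suc[OF assms] by simp
  finally show ?case .
qed

theorem theorem4:
  fixes b N :: nat and t :: "nat \<Rightarrow> nat"
  assumes "b \<ge> 2"
    and "\<forall>j\<in>{1..b}. t j > 0"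
  shows "(\<Prod>i<N. 2 + (\<Sum>j=2..b. Var j ^ (t j ^ i))) =
    (\<Sum>n = ell b N - b ^ N + 2..ell b N + 1.
      mpoly_subst (\<lambda>i. if i = 1 then 1 else Var i) (stern b t n))"
proof -
  have "{ell b N - b ^ N + 2..ell b N + 1} = {repunit b N + 2..<repunit b (Suc N) + 2}"
    unfolding ell_eq_repunit[OF assms(1)] by (auto simp: repunit_Suc')
  then show ?thesis
    unfolding prod_eq_repunit_sum[OF assms(1)] repunit_sum_def stern_at_one_def at_one_def
    by simp
qed

end
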